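(* Let $\Omega \subset \mathbb{R}^d$ be open and non-empty and let $\mu \colon \Omega \to \mathbb{C}^{d \times d}$ be a bounded measurable function. Suppose that there exists an $m > 0$ such that $\operatorname{Re} \big(\mu(x) \xi \cdot \overline{\xi}\big) \geq m \, |\xi|^2$ for all $x \in \Omega$ and all $\xi \in \mathbb{C}^d$. Define the sesquilinear form $\mathfrak{a} \colon W^{1,2}(\Omega) \times W^{1,2}(\Omega) \to \mathbb{C}$ by $$\mathfrak{a}[u,v] = \int_\Omega \mu \nabla u \cdot \overline{\nabla v}.$$ Let $M = \operatorname{ess\,sup}_{x \in \Omega} \|\mu(x)\|$ and $\kappa = \arctan \sqrt{\left(\frac{M}{m}\right)^2 - 1}$. Then $$\mathfrak{a}[u] \in \Sigma(\kappa)$$ for all $u \in W^{1,2}(\Omega)$.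
   Context: For $\theta \in [0,\pi)$, $\Sigma(\theta) = \{ r e^{i\varphi} : r \in [0,\infty),\ \varphi \in [-\theta,\theta] \}$ (a closed set containing $0$). For a sesquilinear form write $\mathfrak{a}[u] = \mathfrak{a}[u,u]$. $\|\mu(x)\|$ is the usual operator norm of the matrix $\mu(x)$ on $\mathbb{C}^d$ (with Euclidean norm), and $\eta \cdot \zeta = \sum_{k} \eta_k \zeta_k$ for $\eta,\zeta\in\mathbb{C}^d$. $W^{1,2}(\Omega)$ is the Sobolev space of complex-valued functions. *)

theory Defs
  imports "HOL-Probability.Essential_Supremum"
begin

definition sector :: "real \<Rightarrow> complex set" where
  "sector \<theta> = {of_real r * exp (\<i> * of_real \<phi>) | r \<phi>. 0 \<le> r \<and> - \<theta> \<le> \<phi> \<and> \<phi> \<le> \<theta>}"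

(* Bilinear: no conjugation is built into this product. *)
definition cdot :: "complex^'d \<Rightarrow> complex^'d \<Rightarrow> complex" (infixl "\<bullet>\<^sub>b" 70) where
  "\<eta> \<bullet>\<^sub>b \<zeta> = (\<Sum>k\<in>UNIV. \<eta> $ k * \<zeta> $ k)"

definition cnj_vec :: "complex^'d \<Rightarrow> complex^'d" where
  "cnj_vec \<zeta> = (\<chi> k. cnj (\<zeta> $ k))"

definition partial_deriv :: "'d::finite \<Rightarrow> (real^'d \<Rightarrow> complex) \<Rightarrow> real^'d \<Rightarrow> complex" where
  "partial_deriv k f x = frechet_derivative f (at x) (axis k 1)"

primrec C_diff :: "nat \<Rightarrow> (real^'d::finite \<Rightarrow> complex) \<Rightarrow> bool" where
  "C_diff 0 f \<longleftrightarrow> continuous_on UNIV f"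
| "C_diff (Suc n) f \<longleftrightarrow> f differentiable_on UNIV \<and> (\<forall>k. C_diff n (partial_deriv k f))"

definition test_functions :: "(real^'d::finite) set \<Rightarrow> (real^'d \<Rightarrow> complex) set" where
  "test_functions \<Omega> = {\<phi>. (\<forall>n. C_diff n \<phi>) \<and>
     compact (closure {x. \<phi> x \<noteq> 0}) \<and> closure {x. \<phi> x \<noteq> 0} \<subseteq> \<Omega>}"

(* Elements of Lebesgue and Sobolev spaces are represented by functions on all of real^'d,
   of which only the values on \<Omega> matter; functions equal a.e. on \<Omega> are not identified. *)
definition L2_on :: "(real^'d::finite) set \<Rightarrow> (real^'d \<Rightarrow> complex) set" where
  "L2_on \<Omega> = {u. u \<in> borel_measurable (lebesgue_on \<Omega>) \<and>
     integrable (lebesgue_on \<Omega>) (\<lambda>x. (cmod (u x))\<^sup>2)}"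

definition is_weak_partial ::
  "(real^'d::finite) set \<Rightarrow> 'd \<Rightarrow> (real^'d \<Rightarrow> complex) \<Rightarrow> (real^'d \<Rightarrow> complex) \<Rightarrow> bool" where
  "is_weak_partial \<Omega> k u g \<longleftrightarrow> (\<forall>\<phi> \<in> test_functions \<Omega>.
     (LINT x|lebesgue_on \<Omega>. u x * partial_deriv k \<phi> x) = - (LINT x|lebesgue_on \<Omega>. g x * \<phi> x))"

definition W12 :: "(real^'d::finite) set \<Rightarrow> (real^'d \<Rightarrow> complex) set" where
  "W12 \<Omega> = {u \<in> L2_on \<Omega>. \<forall>k. \<exists>g \<in> L2_on \<Omega>. is_weak_partial \<Omega> k u g}"

(* Weak derivatives are unique only up to null sets, so a representative is chosen;
   the value is meaningful only for u in W12 \<Omega>. *)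
definition weak_partial ::
  "(real^'d::finite) set \<Rightarrow> 'd \<Rightarrow> (real^'d \<Rightarrow> complex) \<Rightarrow> real^'d \<Rightarrow> complex" where
  "weak_partial \<Omega> k u = (SOME g. g \<in> L2_on \<Omega> \<and> is_weak_partial \<Omega> k u g)"

definition weak_grad ::
  "(real^'d::finite) set \<Rightarrow> (real^'d \<Rightarrow> complex) \<Rightarrow> real^'d \<Rightarrow> complex^'d" where
  "weak_grad \<Omega> u x = (\<chi> k. weak_partial \<Omega> k u x)"

definition elliptic_form ::
  "(real^'d::finite) set \<Rightarrow> (real^'d \<Rightarrow> complex^'d^'d) \<Rightarrow>
   (real^'d \<Rightarrow> complex) \<Rightarrow> (real^'d \<Rightarrow> complex) \<Rightarrow> complex" where
  "elliptic_form \<Omega> \<mu> u v =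
     (LINT x|lebesgue_on \<Omega>. (\<mu> x *v weak_grad \<Omega> u x) \<bullet>\<^sub>b cnj_vec (weak_grad \<Omega> v x))"

(* The essential supremum is taken in ereal, a complete linear order. For a bounded measurable
   coefficient on a non-empty open set it is finite, so real_of_ereal loses nothing. *)
definition ess_bound :: "(real^'d::finite) set \<Rightarrow> (real^'d \<Rightarrow> complex^'d^'d) \<Rightarrow> real" where
  "ess_bound \<Omega> \<mu> =
     real_of_ereal (esssup (lebesgue_on \<Omega>) (\<lambda>x. ereal (onorm (\<lambda>\<xi>. \<mu> x *v \<xi>))))"

end

theory Submission
  imports Defs
begin

text \<open>
  Pointwise, Cauchy--Schwarz and ellipticity bound the modulus of the integrand by \<open>M / m\<close> times
  its real part. By Pythagoras this is the inequality \<open>\<bar>Im z\<bar> \<le> tan \<kappa> * Re z\<close>, which is linear in \<open>z\<close> and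
  therefore passes to the integral.
\<close>

text \<open>Cauchy-Schwarz. The triangle inequality reduces it to the real inequality for the moduli
  of the coordinates.\<close>

lemma cmod_cdot_cnj_le: "cmod (\<eta> \<bullet>\<^sub>b cnj_vec \<zeta>) \<le> norm \<eta> * norm \<zeta>"
proof -
  have "cmod (\<eta> \<bullet>\<^sub>b cnj_vec \<zeta>) \<le> (\<Sum>k\<in>UNIV. \<bar>cmod (\<eta> $ k)\<bar> * \<bar>cmod (\<zeta> $ k)\<bar>)"
    unfolding cdot_def cnj_vec_def
    by (rule order_trans[OF norm_sum]) (simp add: norm_mult)
  also have "\<dots> \<le> norm \<eta> * norm \<zeta>"
    unfolding norm_vec_def by (rule L2_set_mult_ineq)
  finally show ?thesis .
qed

lemma bounded_bilinear_matrix_vector_mult: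
  "bounded_bilinear ((*v) :: complex^'n^'m \<Rightarrow> complex^'n \<Rightarrow> complex^'m)"
  unfolding bilinear_conv_bounded_bilinear[symmetric] bilinear_def
  by (auto intro!: linearI simp: matrix_vector_mult_add_rdistrib matrix_vector_mult_def
      scaleR_sum_right vec_eq_iff distrib_right distrib_left sum.distrib)

text \<open>Compares the operator norm with the Euclidean norm of the entries, which is what
  \<open>norm\<close> means on matrices. Boundedness and continuity with respect to
  \<open>norm\<close> thereby carry over to the operator norm.\<close>

lemma onorm_matrix_bound:
  "\<exists>K\<ge>0. \<forall>A :: complex^'n^'m. onorm ((*v) A) \<le> K * norm A"
proof -
  obtain K where K: "0 < K"
    "\<And>(A :: complex^'n^'m) (x :: complex^'n). norm (A *v x) \<le> norm A * norm x * K"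
    using bounded_bilinear.pos_bounded[OF bounded_bilinear_matrix_vector_mult] by blast
  have "onorm ((*v) A) \<le> K * norm A" for A :: "complex^'n^'m"
    using K by (intro onorm_bound) (auto simp: mult_ac)
  then show ?thesis
    using K(1) less_imp_le by blast
qed

lemma onorm_matrix_le_add:
  fixes A B :: "complex^'n^'m"
  shows "onorm ((*v) A) \<le> onorm ((*v) B) + onorm ((*v) (A - B))"
proof -
  have "(*v) A = (\<lambda>x. B *v x + (A - B) *v x)"
    by (simp add: fun_eq_iff flip: matrix_vector_mult_add_rdistrib)
  then show ?thesis
    using onorm_triangle[OF matrix_vector_mul_bounded_linear matrix_vector_mul_bounded_linear, of B "A - B"]
    by simp
qed

text \<open>The reverse triangle inequality makes the operator norm Lipschitz. Continuity is what
  makes \<open>onorm\<close> of a measurable coefficient measurable.\<close>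

lemma continuous_on_onorm_matrix:
  "continuous_on UNIV (\<lambda>A :: complex^'n^'m. onorm ((*v) A))"
proof -
  obtain K where K: "0 \<le> K" "\<And>A :: complex^'n^'m. onorm ((*v) A) \<le> K * norm A"
    using onorm_matrix_bound by blast
  have "K-lipschitz_on UNIV (\<lambda>A :: complex^'n^'m. onorm ((*v) A))"
  proof (rule lipschitz_onI[OF _ K(1)])
    fix A B :: "complex^'n^'m"
    show "dist (onorm ((*v) A)) (onorm ((*v) B)) \<le> K * dist A B"
      using onorm_matrix_le_add[of A B] onorm_matrix_le_add[of B A] K(2)[of "A - B"] K(2)[of "B - A"]
      by (simp add: dist_norm abs_le_iff norm_minus_commute)
  qed
  then show ?thesis
    by (rule lipschitz_on_continuous_on)
qed

text \<open>Test the coercivity on a single unit vector. This is the source of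
  \<open>m \<le> M\<close>.\<close>

lemma coercive_le_onorm:
  fixes A :: "complex^'d^'d"
  assumes "\<And>\<xi>. Re ((A *v \<xi>) \<bullet>\<^sub>b cnj_vec \<xi>) \<ge> m * (norm \<xi>)\<^sup>2"
  shows "m \<le> onorm ((*v) A)"
proof -
  \<comment> \<open>Any coordinate vector will do; \<open>undefined\<close> merely names some
    index.\<close>
  define e :: "complex^'d" where "e = axis undefined 1"
  have e: "norm e = 1"
    by (simp add: e_def norm_vec_def L2_set_def axis_def if_distrib[of norm] if_distribR
        if_distrib[of "\<lambda>x. x\<^sup>2"] cong: if_cong)
  have "m \<le> cmod ((A *v e) \<bullet>\<^sub>b cnj_vec e)"
    using assms[of e] complex_Re_le_cmod[of "(A *v e) \<bullet>\<^sub>b cnj_vec e"] by (simp add: e)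
  also have "\<dots> \<le> norm (A *v e)"
    using cmod_cdot_cnj_le[of "A *v e" e] by (simp add: e)
  also have "\<dots> \<le> onorm ((*v) A)"
    using onorm[OF matrix_vector_mul_bounded_linear, of A e] by (simp add: e)
  finally show ?thesis .
qed

text \<open>A non-empty open set is not negligible, so a statement free of \<open>x\<close> that
  holds almost everywhere is true.\<close>

lemma ae_filter_lebesgue_on_open_neq_bot:
  assumes "open \<Omega>" "\<Omega> \<noteq> {}"
  shows "ae_filter (lebesgue_on \<Omega>) \<noteq> bot"
proof
  assume "ae_filter (lebesgue_on \<Omega>) = bot"
  then have "emeasure lebesgue \<Omega> = 0"
    using assms(1) by (simp add: ae_filter_eq_bot_iff emeasure_restrict_space)
  then have "negligible \<Omega>"
    using assms(1) by (simp add: negligible_iff_emeasure0)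
  then show False
    using open_not_negligible assms by blast
qed

text \<open>The essential supremum lies between the finite values \<open>m\<close> and
  \<open>K * B\<close>, so \<open>real_of_ereal\<close> preserves it.\<close>

lemma ess_bound_props:
  fixes \<mu> :: "real^'d::finite \<Rightarrow> complex^'d^'d"
  assumes "open \<Omega>" and "\<Omega> \<noteq> {}"
    and bdd: "bounded (\<mu> ` \<Omega>)"
    and meas: "\<mu> \<in> borel_measurable (lebesgue_on \<Omega>)"
    and lower: "\<And>x. x \<in> \<Omega> \<Longrightarrow> m \<le> onorm ((*v) (\<mu> x))"
  shows AE_onorm_le_ess_bound: "AE x in lebesgue_on \<Omega>. onorm ((*v) (\<mu> x)) \<le> ess_bound \<Omega> \<mu>"
    and le_ess_bound: "m \<le> ess_bound \<Omega> \<mu>"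
proof -
  let ?L = "lebesgue_on \<Omega>"
  let ?S = "esssup ?L (\<lambda>x. ereal (onorm ((*v) (\<mu> x))))"
  have spaceL: "space ?L = \<Omega>"
    by simp
  note nontriv = ae_filter_lebesgue_on_open_neq_bot[OF assms(1,2)]
  have onorm_meas: "(\<lambda>x. onorm ((*v) (\<mu> x))) \<in> borel_measurable ?L"
    using measurable_compose[OF meas borel_measurable_continuous_onI[OF continuous_on_onorm_matrix]] .
  obtain K where K: "0 \<le> K" "\<And>A :: complex^'d^'d. onorm ((*v) A) \<le> K * norm A"
    using onorm_matrix_bound by blast
  obtain B where B: "\<And>x. x \<in> \<Omega> \<Longrightarrow> norm (\<mu> x) \<le> B"
    using bdd by (auto simp: bounded_iff)
  have "AE x in ?L. ereal (onorm ((*v) (\<mu> x))) \<le> ereal (K * B)"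
  proof (rule AE_I2)
    fix x assume "x \<in> space ?L"
    then show "ereal (onorm ((*v) (\<mu> x))) \<le> ereal (K * B)"
      using order_trans[OF K(2) mult_left_mono[OF B K(1)]] by (simp add: spaceL)
  qed
  \<comment> \<open>Measurability matters here: \<open>esssup\<close> of a non-measurable function
    is \<open>top\<close> by convention.\<close>
  then have upper: "?S \<le> ereal (K * B)"
    using onorm_meas by (intro esssup_I) auto
  have AE_S: "AE x in ?L. ereal (onorm ((*v) (\<mu> x))) \<le> ?S"
    by (rule esssup_AE)
  moreover have "AE x in ?L. ereal m \<le> ereal (onorm ((*v) (\<mu> x)))"
    using lower by (intro AE_I2) (simp add: spaceL)
  ultimately have "AE x in ?L. ereal m \<le> ?S"
    by eventually_elim (rule order_trans)
  then have S_ge: "ereal m \<le> ?S"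
    using nontriv by simp
  have S_eq: "?S = ereal (ess_bound \<Omega> \<mu>)"
    using upper S_ge unfolding ess_bound_def by (cases ?S) auto
  show "m \<le> ess_bound \<Omega> \<mu>"
    using S_ge by (simp add: S_eq)
  show "AE x in ?L. onorm ((*v) (\<mu> x)) \<le> ess_bound \<Omega> \<mu>"
    using AE_S by (simp add: S_eq)
qed

text \<open>Take radius \<open>0\<close>; the hypothesis makes the range of angles
  non-empty.\<close>

lemma zero_mem_sector: "0 \<le> \<theta> \<Longrightarrow> 0 \<in> sector \<theta>"
  unfolding sector_def by force

lemma mem_sector_arctan:
  assumes "0 \<le> c" and Re: "0 \<le> Re z" and Im: "\<bar>Im z\<bar> \<le> c * Re z"
  shows "z \<in> sector (arctan c)"
proof (cases "Re z = 0")
  case True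
  then have "z = 0"
    using Im by (simp add: complex_eq_iff)
  then show ?thesis
    using assms(1) by (simp add: zero_mem_sector)
next
  case False
  then have pos: "0 < Re z"
    using Re by simp
  have "- c \<le> Im z / Re z \<and> Im z / Re z \<le> c"
    using pos Im by (simp add: abs_le_iff field_simps)
  then have "- arctan c \<le> Arg z \<and> Arg z \<le> arctan c"
    using pos by (simp add: arg_conv_arctan arctan_le_iff flip: arctan_minus)
  \<comment> \<open>The polar form supplies the radius and angle required by
    \<open>sector\<close>.\<close>
  moreover have "z = of_real (cmod z) * exp (\<i> * of_real (Arg z))"
    using rcis_cmod_Arg[of z] by (simp add: rcis_def cis_conv_exp)
  ultimately show ?thesis
    unfolding sector_def mem_Collect_eq by (metis norm_ge_zero)
qed

lemma integral_mem_sector_arctan: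
  assumes "0 \<le> c"
    and Re: "AE x in N. 0 \<le> Re (f x)"
    and Im: "AE x in N. \<bar>Im (f x)\<bar> \<le> c * Re (f x)"
  shows "integral\<^sup>L N f \<in> sector (arctan c)"
proof (cases "integrable N f")
  case True
  have "0 \<le> Re (integral\<^sup>L N f)"
    unfolding integral_Re[OF True, symmetric] using Re by (rule integral_nonneg_AE)
  moreover have "\<bar>\<integral>x. Im (f x) \<partial>N\<bar> \<le> (\<integral>x. \<bar>Im (f x)\<bar> \<partial>N)"
    by (rule integral_abs_bound)
  moreover have "(\<integral>x. \<bar>Im (f x)\<bar> \<partial>N) \<le> (\<integral>x. c * Re (f x) \<partial>N)"
    using True Im by (intro integral_mono_AE) auto
  ultimately show ?thesis
    using True assms(1) by (intro mem_sector_arctan) auto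
next
  case False
  \<comment> \<open>the integral then has the junk value \<open>0\<close>, so no integrability has to be assumed\<close>
  then show ?thesis
    using assms(1) by (simp add: not_integrable_integral_eq zero_mem_sector)
qed

text \<open>Here \<open>t\<close> plays the role of the squared length of the gradient at a point.
  Eliminating it through \<open>t \<le> Re z / m\<close> leaves
  \<open>cmod z \<le> (M / m) * Re z\<close>; square this and subtract the square of
  \<open>Re z\<close>.\<close>

lemma abs_Im_le_sqrt_mult_Re:
  assumes "0 < m" "m \<le> M" "0 \<le> t" and Re: "m * t \<le> Re z" and norm: "cmod z \<le> M * t"
  shows "\<bar>Im z\<bar> \<le> sqrt ((M / m)\<^sup>2 - 1) * Re z"
proof -
  have "M * t \<le> M * (Re z / m)"
    using assms(1,2) Re by (intro mult_left_mono) (auto simp: field_simps)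
  with norm have "cmod z \<le> (M / m) * Re z"
    by simp
  then have "(cmod z)\<^sup>2 \<le> ((M / m) * Re z)\<^sup>2"
    by (intro power_mono) auto
  then have "(Im z)\<^sup>2 \<le> ((M / m)\<^sup>2 - 1) * (Re z)\<^sup>2"
    by (simp add: cmod_power2 power_mult_distrib power_divide left_diff_distrib)
  then have "\<bar>Im z\<bar> \<le> sqrt (((M / m)\<^sup>2 - 1) * (Re z)\<^sup>2)"
    using real_sqrt_le_mono by fastforce
  moreover have "0 \<le> Re z"
    using assms(1,3) Re by (meson mult_nonneg_nonneg less_imp_le order_trans)
  ultimately show ?thesis
    by (simp add: real_sqrt_mult)
qed

theorem theorem2p2:
  fixes \<Omega> :: "(real^'d::finite) set"
    and \<mu> :: "real^'d \<Rightarrow> complex^'d^'d"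
    and m M \<kappa> :: real
  assumes "open \<Omega>" and "\<Omega> \<noteq> {}"
    and "bounded (\<mu> ` \<Omega>)"
    and "\<mu> \<in> borel_measurable (lebesgue_on \<Omega>)"
    and "m > 0"
    and "\<And>x \<xi>. x \<in> \<Omega> \<Longrightarrow> Re ((\<mu> x *v \<xi>) \<bullet>\<^sub>b cnj_vec \<xi>) \<ge> m * (norm \<xi>)\<^sup>2"
    and "M = ess_bound \<Omega> \<mu>"
    and "\<kappa> = arctan (sqrt ((M / m)\<^sup>2 - 1))"
  shows "\<forall>u \<in> W12 \<Omega>. elliptic_form \<Omega> \<mu> u u \<in> sector \<kappa>"
proof
  fix u
  assume "u \<in> W12 \<Omega>"
  let ?L = "lebesgue_on \<Omega>"
  let ?g = "weak_grad \<Omega> u"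
  let ?a = "\<lambda>x. (\<mu> x *v ?g x) \<bullet>\<^sub>b cnj_vec (?g x)"
  have lower: "m \<le> onorm ((*v) (\<mu> x))" if "x \<in> \<Omega>" for x
    using assms(6)[OF that] by (rule coercive_le_onorm)
  have bounds: "AE x in ?L. onorm ((*v) (\<mu> x)) \<le> M" "m \<le> M"
    unfolding assms(7) using ess_bound_props[OF assms(1-4)] lower by blast+
  \<comment> \<open>Makes the radicand nonnegative; \<open>sqrt\<close> takes negative values on
    negative arguments.\<close>
  have "1 \<le> M / m"
    using bounds(2) assms(5) by simp
  then have c: "0 \<le> sqrt ((M / m)\<^sup>2 - 1)"
    by simp
  \<comment> \<open>Ellipticity with the gradient at \<open>x\<close> as the vector
    \<open>\<xi>\<close>.\<close>
  have coercive: "AE x in ?L. m * (norm (?g x))\<^sup>2 \<le> Re (?a x)"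
    using assms(6) by (intro AE_I2) simp
  have Re: "AE x in ?L. 0 \<le> Re (?a x)"
    using coercive by eventually_elim (use assms(5) in \<open>meson mult_nonneg_nonneg less_imp_le order_trans zero_le_power2\<close>)
  have Im: "AE x in ?L. \<bar>Im (?a x)\<bar> \<le> sqrt ((M / m)\<^sup>2 - 1) * Re (?a x)"
    using bounds(1) coercive
  proof eventually_elim
    case (elim x)
    have "cmod (?a x) \<le> norm (\<mu> x *v ?g x) * norm (?g x)"
      by (rule cmod_cdot_cnj_le)
    also have "\<dots> \<le> (onorm ((*v) (\<mu> x)) * norm (?g x)) * norm (?g x)"
      by (intro mult_right_mono onorm matrix_vector_mul_bounded_linear norm_ge_zero)
    also have "\<dots> \<le> M * (norm (?g x))\<^sup>2"
      using elim(1) by (simp add: power2_eq_square mult_right_mono flip: mult.assoc)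
    \<comment> \<open>The scalar lemma is applied with \<open>t\<close> equal to
      \<open>(norm (?g x))\<^sup>2\<close>.\<close>
    finally show ?case
      using abs_Im_le_sqrt_mult_Re[OF assms(5) bounds(2) _ elim(2)] by simp
  qed
  show "elliptic_form \<Omega> \<mu> u u \<in> sector \<kappa>"
    unfolding elliptic_form_def assms(8) using c Re Im by (rule integral_mem_sector_arctan)
qed

end
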